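(* Let $N\ge 2$ be an integer and let $X\subset[0,1]$ be the middle $\frac1N$-th Cantor set. Let $m=\left\lfloor \frac{N}{100\log_2 N}\right\rfloor$. Then for any real numbers $a_1,\dots,a_m$, we have $\bigcap_{i=1}^{m}(X+a_i)\neq\emptyset$, where each translate $X+a_i$ is taken modulo $1$ (i.e. as a subset of $\mathbb{R}/\mathbb{Z}$).
   Context: The middle $\frac1N$-th Cantor set is $X=\bigcap_{k\ge 0}C_k$, where $C_0=[0,1]$ and $C_{k+1}$ is obtained from $C_k$ by removing the open middle interval of length $\frac1N|I|$ from each connected component $I$ of $C_k$. Thus $C_k$ consists of $2^k$ closed intervals of length $\left(\frac{N-1}{2N}\right)^k$. *)

theory Defs
  imports "HOL-Analysis.Analysis"
begin

text \<open>The circle group of reals modulo 1.\<close>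

quotient_type circle = real / "\<lambda>x y :: real. x - y \<in> \<int>"
proof (rule equivpI)
  show "reflp (\<lambda>x y :: real. x - y \<in> \<int>)"
    by (rule reflpI) simp
  show "symp (\<lambda>x y :: real. x - y \<in> \<int>)"
    by (rule sympI) (metis Ints_minus minus_diff_eq)
  show "transp (\<lambda>x y :: real. x - y \<in> \<int>)"
    by (rule transpI) (metis Ints_add diff_add_cancel add_diff_eq)
qed

definition translate_mod1 :: "real set \<Rightarrow> real \<Rightarrow> circle set" where
  "translate_mod1 X a = (\<lambda>x. abs_circle (x + a)) ` X"

text \<open>For a bounded interval \<open>I\<close> with midpoint \<open>c\<close> and length \<open>l\<close>, this is the open
  interval with midpoint \<open>c\<close> and length \<open>l / N\<close>.\<close>

definition open_middle :: "nat \<Rightarrow> real set \<Rightarrow> real set" where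
  "open_middle N I =
     (let c = (Inf I + Sup I) / 2; l = Sup I - Inf I
      in {c - l / (2 * real N) <..< c + l / (2 * real N)})"

primrec cantor_stage :: "nat \<Rightarrow> nat \<Rightarrow> real set" where
  "cantor_stage N 0 = {0..1}"
| "cantor_stage N (Suc k) = (\<Union>I \<in> components (cantor_stage N k). I - open_middle N I)"

definition middle_cantor_set :: "nat \<Rightarrow> real set" where
  "middle_cantor_set N = (\<Inter>k. cantor_stage N k)"

end

theory Submission
  imports Defs
begin

text \<open>Search for a common point along the tree of intervals of the Cantor construction itself,
  whose level-\<open>k\<close> intervals have length \<open>\<rho>\<^sup>k\<close> with \<open>\<rho> = (N - 1) / (2N)\<close>. With \<open>s = \<lfloor>log\<^sub>2 N\<rfloor>\<close>, the
  gaps of length \<open>\<rho>\<^sup>k / N\<close> of the translates are only avoided at level \<open>k + s\<close>, where the tree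
  intervals have become about as long as these gaps. Each surviving interval of level \<open>k\<close> meets
  boundedly many level-\<open>k\<close> gaps of each translate, and each gap kills boundedly many intervals of
  level \<open>k + s\<close>. Hence the number \<open>g\<^sub>k\<close> of survivors satisfies \<open>g\<^sub>k\<^sub>+\<^sub>s \<ge> 2 g\<^sub>k\<^sub>+\<^sub>s\<^sub>-\<^sub>1 - 10 m g\<^sub>k\<close>, and
  inductively \<open>g\<^sub>k\<^sub>+\<^sub>1 \<ge> (2 - 1/s) g\<^sub>k > 0\<close>: since \<open>(2 - 1/s)\<^sup>s\<close> is of order \<open>N\<close>, the loss is at most
  \<open>g\<^sub>k\<^sub>+\<^sub>s\<^sub>-\<^sub>1 / s\<close> as long as \<open>m\<close> is a small multiple of \<open>N / s\<close>. Compactness then yields a point.\<close>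

section \<open>Separated sets and unions of separated intervals\<close>

definition separated :: "real \<Rightarrow> real set \<Rightarrow> bool" where
  "separated r S \<longleftrightarrow> (\<forall>x\<in>S. \<forall>y\<in>S. x \<noteq> y \<longrightarrow> r \<le> \<bar>x - y\<bar>)"

lemma separated_subset: "separated r S \<Longrightarrow> T \<subseteq> S \<Longrightarrow> separated r T"
  unfolding separated_def by blast

text \<open>Cut the line into cells of length \<open>r\<close> starting at \<open>u\<close>: two
  points in one cell differ by less than \<open>r\<close>, so the cell index is injective on
  \<open>S\<close>.\<close>

lemma card_separated:
  assumes "separated r S" "r > 0" "S \<subseteq> {u..u + l}" "l \<ge> 0"
  shows "finite S" "real (card S) \<le> l / r + 1"
proof -
  let ?f = "\<lambda>x. nat \<lfloor>(x - u) / r\<rfloor>"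
  have inj: "inj_on ?f S"
  proof (rule inj_onI)
    fix x y assume xy: "x \<in> S" "y \<in> S" "?f x = ?f y"
    have "(x - u) / r \<ge> 0" "(y - u) / r \<ge> 0"
      using xy assms by (auto intro!: divide_nonneg_pos)
    then have "\<lfloor>(x - u) / r\<rfloor> = \<lfloor>(y - u) / r\<rfloor>"
      using xy(3) by (simp add: nat_eq_iff)
    then have "\<bar>(x - u) / r - (y - u) / r\<bar> < 1" by linarith
    moreover have "(x - u) / r - (y - u) / r = (x - y) / r"
      by (simp add: diff_divide_distrib)
    ultimately have "\<bar>x - y\<bar> < r" using \<open>r > 0\<close> by (simp add: field_simps)
    then show "x = y" using assms(1) xy unfolding separated_def by force
  qed
  have sub: "?f ` S \<subseteq> {..nat \<lfloor>l / r\<rfloor>}"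
    using assms by (auto intro!: nat_mono floor_mono divide_right_mono)
  show "finite S" using inj sub by (meson finite_atMost finite_imageD finite_subset)
  have "card S \<le> card {..nat \<lfloor>l / r\<rfloor>}"
    using inj sub by (intro card_inj_on_le) auto
  then have "real (card S) \<le> real (nat \<lfloor>l / r\<rfloor>) + 1" by simp
  also have "real (nat \<lfloor>l / r\<rfloor>) \<le> l / r" using assms by (simp add: of_nat_floor)
  finally show "real (card S) \<le> l / r + 1" by simp
qed

text \<open>Translates the component-based definition of \<open>cantor_stage\<close> into explicit
  intervals. A connected set cannot leave an interval because it would have to cross a hole of
  length at least \<open>d\<close>.\<close>

lemma components_separated_intervals:
  fixes r d :: real
  assumes r: "r \<ge> 0" and d: "d > 0" and sep: "separated (r + d) L"
  shows "components (\<Union>l\<in>L. {l..l + r}) = (\<lambda>l. {l..l + r}) ` L"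
proof -
  let ?U = "\<Union>l\<in>L. {l..l + r}"
  have block: "\<exists>z. z \<notin> ?U \<and> min x y < z \<and> z < max x y"
    if l: "l \<in> L" "x \<in> {l..l + r}" and y: "y \<notin> {l..l + r}" for l x y
  proof -
    \<comment> \<open>The point \<open>z\<close> lies just outside the interval on the side of
      \<open>y\<close>; \<open>e\<close> is small enough to stop before \<open>y\<close> and before
      any other interval.\<close>
    define e where "e = min (d / 2) (if y > l + r then (y - (l + r)) / 2 else (l - y) / 2)"
    define z where "z = (if y > l + r then l + r + e else l - e)"
    have e: "e > 0" "e \<le> d / 2" "y > l + r \<Longrightarrow> l + r + e < y" "\<not> y > l + r \<Longrightarrow> y < l - e"
      using d y r by (auto simp: e_def min_less_iff_disj field_simps min_def)
    have "z \<notin> ?U"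
    proof
      assume "z \<in> ?U"
      then obtain l' where l': "l' \<in> L" "z \<in> {l'..l' + r}" by blast
      have "l' \<noteq> l" using l'(2) e r unfolding z_def by (auto split: if_splits)
      then have "r + d \<le> \<bar>l' - l\<bar>" using sep l(1) l'(1) unfolding separated_def by blast
      then show False using l'(2) e d r unfolding z_def by (auto split: if_splits)
    qed
    moreover have "min x y < z" "z < max x y"
      using l(2) e(1,3,4) unfolding z_def by (auto simp: min_less_iff_disj less_max_iff_disj)
    ultimately show ?thesis by blast
  qed
  have cc: "connected_component_set ?U x = {l..l + r}" if l: "l \<in> L" "x \<in> {l..l + r}" for l x
  proof (rule connected_component_unique)
    show "x \<in> {l..l + r}" "{l..l + r} \<subseteq> ?U" "connected {l..l + r}" using l by auto
    fix T assume T: "x \<in> T" "T \<subseteq> ?U" "connected T"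
    show "T \<subseteq> {l..l + r}"
    proof
      fix y assume "y \<in> T"
      show "y \<in> {l..l + r}"
      proof (rule ccontr)
        assume "y \<notin> {l..l + r}"
        then obtain z where z: "z \<notin> ?U" "min x y < z" "z < max x y" using block l by blast
        have "min x y \<in> T" "max x y \<in> T" using T(1) \<open>y \<in> T\<close> by (auto simp: min_def max_def)
        then have "z \<in> T" using T(3) z by (meson connectedD_interval less_imp_le)
        then show False using z(1) T(2) by blast
      qed
    qed
  qed
  show ?thesis
  proof (intro equalityI subsetI)
    fix c assume "c \<in> components ?U"
    then obtain x where "x \<in> ?U" "c = connected_component_set ?U x" by (rule componentsE)
    then show "c \<in> (\<lambda>l. {l..l + r}) ` L" using cc by blast
  next
    fix c assume "c \<in> (\<lambda>l. {l..l + r}) ` L"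
    then obtain l where "l \<in> L" "c = {l..l + r}" by blast
    moreover from this have "c = connected_component_set ?U l" "l \<in> ?U" using cc r by force+
    ultimately show "c \<in> components ?U" unfolding components_def by blast
  qed
qed

section \<open>The Cantor construction as a tree of left endpoints\<close>

locale middle_cantor =
  fixes N :: nat
  assumes N_ge_2: "N \<ge> 2"
begin

definition \<rho> :: real where "\<rho> = (real N - 1) / (2 * real N)"

lemma \<rho>_pos: "\<rho> > 0" and \<rho>_lt_1: "\<rho> < 1" and \<rho>_eq: "2 * \<rho> + 1 / real N = 1"
  using N_ge_2 by (auto simp: \<rho>_def field_simps)

lemma \<rho>_power_split: "\<rho> ^ k = 2 * \<rho> ^ Suc k + \<rho> ^ k / real N"
proof -
  have "\<rho> ^ k * 1 = \<rho> ^ k * (2 * \<rho> + 1 / real N)" by (simp only: \<rho>_eq)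
  then show ?thesis by (simp add: algebra_simps)
qed

text \<open>The left endpoints of the children of the level-\<open>k\<close> intervals with left endpoints in \<open>A\<close>.\<close>

definition children :: "nat \<Rightarrow> real set \<Rightarrow> real set" where
  "children k A = A \<union> (\<lambda>l. l + (\<rho> ^ k - \<rho> ^ Suc k)) ` A"

primrec lefts :: "nat \<Rightarrow> real set" where
  "lefts 0 = {0}"
| "lefts (Suc k) = children k (lefts k)"

lemma children_mono: "A \<subseteq> B \<Longrightarrow> children k A \<subseteq> children k B"
  unfolding children_def by blast

lemma finite_children: "finite A \<Longrightarrow> finite (children k A)"
  unfolding children_def by blast

lemma power_\<rho>_Suc_le: "\<rho> ^ Suc k \<le> \<rho> ^ k"
  using \<rho>_pos \<rho>_lt_1 by (intro power_decreasing) auto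

lemma lefts_bounds: "lefts k \<subseteq> {0..1 - \<rho> ^ k}"
proof (induction k)
  case (Suc k)
  show ?case
    using Suc power_\<rho>_Suc_le[of k] by (auto simp: children_def)
qed simp

text \<open>Siblings lie exactly \<open>D\<close> apart, and children of different parents lose at
  most \<open>D\<close> of their parents' distance; both cases leave at least
  \<open>\<rho> ^ Suc k + \<rho> ^ k / real N\<close>. The gap term is what identifies the intervals
  as components.\<close>

lemma separated_lefts: "separated (\<rho> ^ k + \<rho> ^ k / real N) (lefts k)"
proof (induction k)
  case (Suc k)
  have eq: "\<rho> ^ k - \<rho> ^ Suc k = \<rho> ^ Suc k + \<rho> ^ k / real N" using \<rho>_power_split[of k] by linarith
  have le: "\<rho> ^ Suc k / real N \<le> \<rho> ^ k / real N"
    using power_\<rho>_Suc_le by (intro divide_right_mono) auto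
  have pos: "\<rho> ^ Suc k > 0" "\<rho> ^ k / real N > 0" using \<rho>_pos N_ge_2 by auto
  define D where "D = \<rho> ^ k - \<rho> ^ Suc k"
  have sep: "l = l' \<or> \<rho> ^ k + \<rho> ^ k / real N \<le> \<bar>l - l'\<bar>"
    if "l \<in> lefts k" "l' \<in> lefts k" for l l'
    using Suc that unfolding separated_def by blast
  show ?case unfolding separated_def
  proof (intro ballI impI)
    fix x y assume x: "x \<in> lefts (Suc k)" and y: "y \<in> lefts (Suc k)" and "x \<noteq> y"
    from x obtain l where l: "l \<in> lefts k" "x = l \<or> x = l + D"
      by (auto simp: children_def D_def)
    from y obtain l' where l': "l' \<in> lefts k" "y = l' \<or> y = l' + D"
      by (auto simp: children_def D_def)
    have "D > 0" using eq pos unfolding D_def by linarith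
    from sep[OF l(1) l'(1)] show "\<rho> ^ Suc k + \<rho> ^ Suc k / real N \<le> \<bar>x - y\<bar>"
    proof
      assume "l = l'"
      then have "\<bar>x - y\<bar> = D" using l(2) l'(2) \<open>x \<noteq> y\<close> \<open>D > 0\<close> by auto
      then show ?thesis using eq le unfolding D_def by linarith
    next
      assume "\<rho> ^ k + \<rho> ^ k / real N \<le> \<bar>l - l'\<bar>"
      moreover have "\<bar>l - l'\<bar> - D \<le> \<bar>x - y\<bar>" using l(2) l'(2) \<open>D > 0\<close> by auto
      ultimately show ?thesis using le unfolding D_def by linarith
    qed
  qed
qed (simp add: separated_def)

lemma separated_lefts_weak: "separated (\<rho> ^ k) (lefts k)"
proof -
  have "0 \<le> \<rho> ^ k / real N" using \<rho>_pos by simp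
  then show ?thesis using separated_lefts[of k] unfolding separated_def by force
qed

lemma card_children:
  assumes "A \<subseteq> lefts k" "finite A"
  shows "card (children k A) = 2 * card A"
proof -
  define D where "D = \<rho> ^ k - \<rho> ^ Suc k"
  have D: "0 < D" "D < \<rho> ^ k"
    using \<rho>_power_split[of k] \<rho>_pos N_ge_2
    unfolding D_def by (auto simp: field_simps \<rho>_lt_1)
  have "A \<inter> (\<lambda>l. l + D) ` A = {}"
  proof (rule ccontr)
    assume "A \<inter> (\<lambda>l. l + D) ` A \<noteq> {}"
    then obtain l l' where "l \<in> A" "l' \<in> A" "l = l' + D" by blast
    then show False
      using D separated_lefts_weak[of k] assms(1) unfolding separated_def by force
  qed
  then show ?thesis
    using assms(2) unfolding children_def D_def[symmetric]
    by (simp add: card_Un_disjoint card_image)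
qed

lemma open_middle_interval:
  "open_middle N {l..l + \<rho> ^ k} = {l + \<rho> ^ Suc k<..<l + \<rho> ^ Suc k + \<rho> ^ k / real N}"
proof -
  have "\<rho> ^ k > 0" using \<rho>_pos by simp
  then have "Inf {l..l + \<rho> ^ k} = l" "Sup {l..l + \<rho> ^ k} = l + \<rho> ^ k" by simp_all
  moreover have "(l + (l + \<rho> ^ k)) / 2 - (l + \<rho> ^ k - l) / (2 * real N)
      = l + (\<rho> ^ k - \<rho> ^ k / real N) / 2"
    "(l + (l + \<rho> ^ k)) / 2 + (l + \<rho> ^ k - l) / (2 * real N)
      = l + (\<rho> ^ k + \<rho> ^ k / real N) / 2"
    by (simp_all add: field_simps)
  ultimately have "open_middle N {l..l + \<rho> ^ k} =
      {l + (\<rho> ^ k - \<rho> ^ k / real N) / 2<..<l + (\<rho> ^ k + \<rho> ^ k / real N) / 2}"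
    unfolding open_middle_def Let_def by simp
  moreover have "\<rho> ^ k - \<rho> ^ k / real N = 2 * \<rho> ^ Suc k"
    "\<rho> ^ k + \<rho> ^ k / real N = 2 * (\<rho> ^ Suc k + \<rho> ^ k / real N)"
    using \<rho>_power_split[of k] by (simp_all only: distrib_left)
  then have "(\<rho> ^ k - \<rho> ^ k / real N) / 2 = \<rho> ^ Suc k"
    "(\<rho> ^ k + \<rho> ^ k / real N) / 2 = \<rho> ^ Suc k + \<rho> ^ k / real N"
    by (simp_all only: nonzero_mult_div_cancel_left[OF zero_neq_numeral[symmetric]])
  ultimately show ?thesis by (simp add: add.assoc)
qed

lemma cantor_stage_eq: "cantor_stage N k = (\<Union>l\<in>lefts k. {l..l + \<rho> ^ k})"
proof (induction k)
  case (Suc k)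
  have pos: "\<rho> ^ k > 0" "\<rho> ^ Suc k > 0" "\<rho> ^ k / real N > 0" using \<rho>_pos N_ge_2 by auto
  have "components (cantor_stage N k) = (\<lambda>l. {l..l + \<rho> ^ k}) ` lefts k"
    unfolding Suc using pos
    by (intro components_separated_intervals[where d = "\<rho> ^ k / real N"] separated_lefts) auto
  then have "cantor_stage N (Suc k) =
      (\<Union>l\<in>lefts k. {l..l + \<rho> ^ k} - {l + \<rho> ^ Suc k<..<l + \<rho> ^ Suc k + \<rho> ^ k / real N})"
    by (simp add: open_middle_interval del: power_Suc)
  also have "\<dots> = (\<Union>l\<in>lefts k. {l..l + \<rho> ^ Suc k} \<union>
      {l + (\<rho> ^ k - \<rho> ^ Suc k)..l + (\<rho> ^ k - \<rho> ^ Suc k) + \<rho> ^ Suc k})"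
  proof (rule SUP_cong[OF refl])
    fix l
    show "{l..l + \<rho> ^ k} - {l + \<rho> ^ Suc k<..<l + \<rho> ^ Suc k + \<rho> ^ k / real N} =
      {l..l + \<rho> ^ Suc k} \<union> {l + (\<rho> ^ k - \<rho> ^ Suc k)..l + (\<rho> ^ k - \<rho> ^ Suc k) + \<rho> ^ Suc k}"
      using \<rho>_power_split[of k] pos by (auto simp del: power_Suc)
  qed
  also have "\<dots> = (\<Union>l\<in>lefts (Suc k). {l..l + \<rho> ^ Suc k})"
    by (auto simp: children_def simp del: power_Suc)
  finally show ?case .
qed simp

text \<open>Descend the tree: a point of an interval that misses its middle gap lies in one of the
  two children.\<close>

lemma middle_cantor_setI:
  assumes "y \<in> {0..1}"
    and "\<And>k l. l \<in> lefts k \<Longrightarrow> y \<notin> {l + \<rho> ^ Suc k<..<l + \<rho> ^ Suc k + \<rho> ^ k / real N}"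
  shows "y \<in> middle_cantor_set N"
proof -
  have "y \<in> cantor_stage N k" for k
  proof (induction k)
    case (Suc k)
    then obtain l where l: "l \<in> lefts k" "y \<in> {l..l + \<rho> ^ k}" by (auto simp: cantor_stage_eq)
    have "l + (\<rho> ^ k - \<rho> ^ Suc k) \<in> lefts (Suc k)" "l \<in> lefts (Suc k)"
      using l(1) by (auto simp: children_def)
    moreover have "y \<in> {l..l + \<rho> ^ Suc k} \<or>
        y \<in> {l + (\<rho> ^ k - \<rho> ^ Suc k)..l + (\<rho> ^ k - \<rho> ^ Suc k) + \<rho> ^ Suc k}"
      using l(2) assms(2)[OF l(1)] \<rho>_power_split[of k] by (auto simp del: power_Suc)
    ultimately show ?case unfolding cantor_stage_eq by blast
  qed (use assms in simp)
  then show ?thesis unfolding middle_cantor_set_def by blast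
qed

section \<open>The delay \<open>depth\<close> before gaps are tested\<close>

definition depth :: nat where "depth = nat \<lfloor>log 2 (real N)\<rfloor>"

lemma depth_pos: "depth \<ge> 1" and depth_le: "2 ^ depth \<le> N" and depth_gt: "N < 2 * 2 ^ depth"
  and depth_le_log: "real depth \<le> log 2 (real N)"
proof -
  have log: "log 2 (real N) \<ge> 1" using N_ge_2 by (simp add: le_log_iff)
  then show "depth \<ge> 1" "real depth \<le> log 2 (real N)"
    unfolding depth_def by (auto simp: le_nat_iff)
  then have "2 powr real depth \<le> real N" using N_ge_2 by (simp add: le_log_iff)
  then show "2 ^ depth \<le> N" by (simp add: powr_realpow)
  have "log 2 (real N) < real depth + 1" using log unfolding depth_def by linarith
  then have "real N < 2 powr (real depth + 1)" using N_ge_2 by (simp add: log_less_iff)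
  then have "real N < real (2 * 2 ^ depth)" by (simp add: powr_realpow powr_add)
  then show "N < 2 * 2 ^ depth" by linarith
qed

text \<open>Compares a level-\<open>k\<close> gap with a tree interval of level
  \<open>k + depth\<close>. Here \<open>2 * \<rho>\<close> is 1 - 1/N, whose \<open>depth\<close>-th
  power is at least 1/2 by Bernoulli, as 2 * \<open>depth\<close> \<le> N; and 2 ^
  \<open>depth\<close> \<le> N.\<close>

lemma \<rho>_power_depth: "1 / (real N * \<rho> ^ depth) \<le> 2"
proof -
  have "2 * depth \<le> 2 ^ depth"
  proof -
    have "2 * Suc n \<le> 2 ^ Suc n" for n :: nat by (induction n) auto
    from this[of "depth - 1"] show ?thesis using depth_pos by simp
  qed
  then have "real (2 * depth) \<le> real N" using depth_le by linarith
  then have "1 / 2 \<le> 1 + real depth * (- 1 / real N)" using N_ge_2 by (simp add: field_simps)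
  also have "\<dots> \<le> (1 + (- 1 / real N)) ^ depth"
    using N_ge_2 by (intro Bernoulli_inequality) (auto simp: field_simps)
  also have "1 + (- 1 / real N) = 2 * \<rho>" using \<rho>_eq by simp
  finally have "1 \<le> 2 * (2 ^ depth * \<rho> ^ depth)" by (simp add: power_mult_distrib)
  also have "2 ^ depth * \<rho> ^ depth \<le> real N * \<rho> ^ depth"
    using of_nat_mono[OF depth_le, where 'a = real] \<rho>_pos by (intro mult_right_mono) auto
  finally show ?thesis using \<rho>_pos N_ge_2 by (simp add: divide_le_eq)
qed

end

section \<open>Survivors of the delayed gap tests\<close>

text \<open>\<open>P i k\<close> stands for the left endpoints, in all periods, of the level-\<open>k\<close> gaps of the \<open>i\<close>-th translate.\<close>

locale avoidance = middle_cantor +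
  fixes m :: nat and P :: "nat \<Rightarrow> nat \<Rightarrow> real set"
  assumes separated_P: "\<And>i k. separated (\<rho> ^ k) (P i k)"
    and m_le: "100 * real m * real depth \<le> real N"
begin

text \<open>Level \<open>j\<close> tests the gaps of level \<open>j - depth\<close>. The guard keeps
  truncated subtraction from testing level-0 gaps too early.\<close>

definition meets_gap :: "nat \<Rightarrow> real \<Rightarrow> bool" where
  "meets_gap j b \<longleftrightarrow> depth \<le> j \<and> (\<exists>i\<in>{1..m}. \<exists>p\<in>P i (j - depth).
     {b..b + \<rho> ^ j} \<inter> {p<..<p + \<rho> ^ (j - depth) / real N} \<noteq> {})"

primrec survivors :: "nat \<Rightarrow> real set" where
  "survivors 0 = {0}"
| "survivors (Suc k) = {b \<in> children k (survivors k). \<not> meets_gap (Suc k) b}"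

lemma survivors_subset: "survivors k \<subseteq> lefts k"
proof (induction k)
  case (Suc k)
  then show ?case using children_mono[OF Suc, of k] by auto
qed simp

lemma finite_survivors: "finite (survivors k)"
  by (induction k) (simp_all add: finite_children)

lemma child_interval_subset:
  assumes "b \<in> children k A"
  obtains v where "v \<in> A" "{b..b + \<rho> ^ Suc k} \<subseteq> {v..v + \<rho> ^ k}"
proof -
  have "\<exists>v\<in>A. v \<le> b \<and> b + \<rho> ^ Suc k \<le> v + \<rho> ^ k"
  proof -
    from assms obtain v where "v \<in> A" "b = v \<or> b = v + (\<rho> ^ k - \<rho> ^ Suc k)"
      unfolding children_def by blast
    then show ?thesis using power_\<rho>_Suc_le[of k] by (intro bexI[of _ v]) linarith+
  qed
  then show thesis using that by (meson atLeastatMost_subset_iff)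
qed

text \<open>Used both to charge losses to survivors \<open>depth\<close> levels up and to nest the
  compact sets of the final limit.\<close>

lemma survivor_ancestor:
  assumes "b \<in> survivors (k + t)"
  obtains v where "v \<in> survivors k" "{b..b + \<rho> ^ (k + t)} \<subseteq> {v..v + \<rho> ^ k}"
  using assms
proof (induction t arbitrary: b thesis)
  case (Suc t)
  obtain c where "c \<in> survivors (k + t)" "{b..b + \<rho> ^ Suc (k + t)} \<subseteq> {c..c + \<rho> ^ (k + t)}"
    using Suc.prems(2) child_interval_subset by (metis (no_types, lifting) add_Suc_right mem_Collect_eq survivors.simps(2))
  then show ?case using Suc by (metis add_Suc_right order_trans)
qed auto

text \<open>The left endpoints are \<open>\<rho> ^ k\<close>-separated in a window as long as the
  interval and a gap together, which gives 2 + 1/N.\<close>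

lemma card_gaps_meeting:
  fixes v :: real and i k :: nat
  defines "Q \<equiv> {p \<in> P i k. {v..v + \<rho> ^ k} \<inter> {p<..<p + \<rho> ^ k / real N} \<noteq> {}}"
  shows "finite Q" "real (card Q) \<le> 5 / 2"
proof -
  have pos: "\<rho> ^ k > 0" using \<rho>_pos by simp
  have Q: "separated (\<rho> ^ k) Q" using separated_P by (rule separated_subset) (auto simp: Q_def)
  have sub: "Q \<subseteq> {v - \<rho> ^ k / real N..(v - \<rho> ^ k / real N) + (\<rho> ^ k + \<rho> ^ k / real N)}"
    unfolding Q_def by auto
  note card = card_separated[OF Q pos sub]
  show "finite Q" using card pos by simp
  have "real (card Q) \<le> (\<rho> ^ k + \<rho> ^ k / real N) / \<rho> ^ k + 1" using card pos by simp
  also have "\<dots> = 2 + 1 / real N" using less_imp_neq[OF pos] by (simp add: add_divide_distrib)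
  also have "\<dots> \<le> 5 / 2" using N_ge_2 by (simp add: field_simps)
  finally show "real (card Q) \<le> 5 / 2" .
qed

text \<open>The dual count: the window is again interval plus gap, but now measured in units of the
  short interval, where the gap has length at most 2 by \<open>\<rho>_power_depth\<close>.\<close>

lemma card_intervals_meeting_gap:
  fixes p :: real and k :: nat
  defines "B \<equiv> {b \<in> lefts (k + depth). {b..b + \<rho> ^ (k + depth)} \<inter> {p<..<p + \<rho> ^ k / real N} \<noteq> {}}"
  shows "finite B" "real (card B) \<le> 4"
proof -
  have pos: "\<rho> ^ (k + depth) > 0" "\<rho> ^ k > 0" using \<rho>_pos by simp_all
  have B: "separated (\<rho> ^ (k + depth)) B"
    using separated_lefts_weak by (rule separated_subset) (auto simp: B_def)
  have sub: "B \<subseteq> {p - \<rho> ^ (k + depth)..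
      (p - \<rho> ^ (k + depth)) + (\<rho> ^ (k + depth) + \<rho> ^ k / real N)}"
    unfolding B_def by auto
  note card = card_separated[OF B pos(1) sub]
  show "finite B" using card pos by simp
  have "real (card B) \<le> (\<rho> ^ (k + depth) + \<rho> ^ k / real N) / \<rho> ^ (k + depth) + 1"
    using card pos by simp
  also have "\<dots> = 2 + 1 / (real N * \<rho> ^ depth)"
    using pos \<rho>_pos by (simp add: add_divide_distrib power_add)
  also have "\<dots> \<le> 4" using \<rho>_power_depth by simp
  finally show "real (card B) \<le> 4" .
qed

text \<open>Each lost child is charged to a triple: a survivor \<open>v\<close> of level
  \<open>k\<close>, a translate \<open>i\<close>, and a gap \<open>p\<close> meeting
  \<open>v\<close>. The constant 10 is 5/2 gaps times 4 intervals.\<close>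

lemma card_lost:
  assumes "Suc n = k + depth"
  shows "real (card (children n (survivors n) - survivors (Suc n)))
    \<le> 10 * real m * real (card (survivors k))"
proof -
  define Q where "Q v i = {p \<in> P i k. {v..v + \<rho> ^ k} \<inter> {p<..<p + \<rho> ^ k / real N} \<noteq> {}}" for v i
  define B where
    "B p = {b \<in> lefts (k + depth). {b..b + \<rho> ^ (k + depth)} \<inter> {p<..<p + \<rho> ^ k / real N} \<noteq> {}}" for p
  have Q: "finite (Q v i)" "real (card (Q v i)) \<le> 5 / 2" for v i
    using card_gaps_meeting unfolding Q_def by blast+
  have B: "finite (B p)" "real (card (B p)) \<le> 4" for p
    using card_intervals_meeting_gap unfolding B_def by blast+
  have n: "n = k + (depth - 1)" using assms depth_pos by simp
  have lost: "children n (survivors n) - survivors (Suc n)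
    \<subseteq> (\<Union>v\<in>survivors k. \<Union>i\<in>{1..m}. \<Union>p\<in>Q v i. B p)"
  proof
    fix b assume b: "b \<in> children n (survivors n) - survivors (Suc n)"
    then have "meets_gap (k + depth) b" unfolding assms[symmetric] by simp
    then obtain i p where ip: "i \<in> {1..m}" "p \<in> P i k"
      "{b..b + \<rho> ^ (k + depth)} \<inter> {p<..<p + \<rho> ^ k / real N} \<noteq> {}"
      unfolding meets_gap_def add_diff_cancel_right' by blast
    have "b \<in> lefts (k + depth)"
      using b children_mono[OF survivors_subset, of n n] assms by (metis DiffD1 lefts.simps(2) subsetD)
    then have "b \<in> B p" using ip unfolding B_def by blast
    obtain c where c: "c \<in> survivors n" "{b..b + \<rho> ^ Suc n} \<subseteq> {c..c + \<rho> ^ n}"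
      using b child_interval_subset by blast
    \<comment> \<open>The ancestor is taken through the parent \<open>c\<close>, since
      \<open>b\<close> itself does not survive.\<close>
    obtain v where v: "v \<in> survivors k" "{c..c + \<rho> ^ n} \<subseteq> {v..v + \<rho> ^ k}"
      using c(1) survivor_ancestor unfolding n by blast
    have "p \<in> Q v i" using ip c(2) v(2) unfolding Q_def assms by blast
    then show "b \<in> (\<Union>v\<in>survivors k. \<Union>i\<in>{1..m}. \<Union>p\<in>Q v i. B p)"
      using v(1) ip(1) \<open>b \<in> B p\<close> by blast
  qed
  have "card (children n (survivors n) - survivors (Suc n))
      \<le> card (\<Union>v\<in>survivors k. \<Union>i\<in>{1..m}. \<Union>p\<in>Q v i. B p)"
    using lost Q B finite_survivors by (intro card_mono) auto
  also have "\<dots> \<le> (\<Sum>v\<in>survivors k. \<Sum>i\<in>{1..m}. \<Sum>p\<in>Q v i. card (B p))"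
    using finite_survivors Q
    by (intro order_trans[OF card_UN_le] sum_mono) auto
  finally have "real (card (children n (survivors n) - survivors (Suc n)))
      \<le> (\<Sum>v\<in>survivors k. \<Sum>i\<in>{1..m}. \<Sum>p\<in>Q v i. real (card (B p)))"
    by (simp flip: of_nat_sum)
  also have "\<dots> \<le> (\<Sum>v\<in>survivors k. \<Sum>i\<in>{1..m}. 10)"
  proof (intro sum_mono)
    fix v i
    have "(\<Sum>p\<in>Q v i. real (card (B p))) \<le> real (card (Q v i)) * 4"
      using B by (intro sum_bounded_above) auto
    then show "(\<Sum>p\<in>Q v i. real (card (B p))) \<le> 10" using Q(2)[of v i] by linarith
  qed
  finally show ?thesis by (simp add: mult_ac)
qed

text \<open>A loss of one part in \<open>depth\<close> per step costs only a bounded factor over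
  \<open>depth - 1\<close> steps.\<close>

definition growth :: real where "growth = 2 - 1 / real depth"

lemma growth_ge_1: "growth \<ge> 1"
  using depth_pos by (simp add: growth_def field_simps)

text \<open>Bernoulli bounds the loss against 2 ^ (\<open>depth\<close> - 1) by a factor 2, and N <
  2 * 2 ^ \<open>depth\<close> contributes the remaining factor 4.\<close>

lemma growth_power: "real N / 8 \<le> growth ^ (depth - 1)"
proof -
  define s where "s = real depth"
  have s: "s \<ge> 1" using depth_pos by (simp add: s_def)
  have "1 / 2 \<le> 1 + real (depth - 1) * (- 1 / (2 * s))"
    using s depth_pos by (simp add: s_def of_nat_diff field_simps)
  also have "\<dots> \<le> (1 + (- 1 / (2 * s))) ^ (depth - 1)"
    using s by (intro Bernoulli_inequality) (auto simp: field_simps)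
  finally have "2 ^ (depth - 1) * (1 / 2) \<le> 2 ^ (depth - 1) * (1 + (- 1 / (2 * s))) ^ (depth - 1)"
    by (intro mult_left_mono) auto
  also have "\<dots> = (2 * (1 + (- 1 / (2 * s)))) ^ (depth - 1)" by (simp only: power_mult_distrib)
  also have "2 * (1 + (- 1 / (2 * s))) = growth" using s by (simp add: growth_def s_def field_simps)
  finally have "2 ^ (depth - 1) \<le> 2 * growth ^ (depth - 1)" by simp
  moreover have "real N < 2 * 2 ^ depth" 
    using of_nat_less_iff[where 'a = real, THEN iffD2, OF depth_gt] by simp
  moreover have "(2::real) ^ depth = 2 * 2 ^ (depth - 1)" using depth_pos by (simp flip: power_Suc)
  ultimately show ?thesis by linarith
qed

text \<open>Growth at the earlier steps makes level \<open>k\<close> small compared with level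
  \<open>n\<close>, so the 10 m losses per level-\<open>k\<close> survivor amount to at most one
  part in \<open>depth\<close> of level \<open>n\<close>.\<close>

lemma card_survivors_growth: "growth * real (card (survivors n)) \<le> real (card (survivors (Suc n)))"
proof (induction n rule: less_induct)
  case (less n)
  let ?g = "\<lambda>k. real (card (survivors k))"
  have children: "real (card (children n (survivors n))) = 2 * ?g n"
    using card_children[OF survivors_subset finite_survivors] by simp
  show ?case
  proof (cases "Suc n < depth")
    case True
    \<comment> \<open>No gap is tested before level \<open>depth\<close>, so every child
      survives.\<close>
    then have "survivors (Suc n) = children n (survivors n)" by (auto simp: meets_gap_def)
    then have "?g (Suc n) = 2 * ?g n" using children by simp
    then show ?thesis using depth_pos by (simp add: growth_def mult_right_mono)
  next
    case False
    then obtain k where k: "Suc n = k + depth" by (metis add.commute le_iff_add not_less)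
    have n_eq: "n = k + (depth - 1)" using k depth_pos by simp
    have "growth ^ t * ?g k \<le> ?g (k + t)" if "k + t \<le> n" for t
      using that
    proof (induction t)
      case (Suc t)
      have "growth ^ Suc t * ?g k = growth * (growth ^ t * ?g k)" by simp
      also have "\<dots> \<le> growth * ?g (k + t)" using Suc growth_ge_1 by (intro mult_left_mono) auto
      also have "\<dots> \<le> ?g (k + Suc t)" using less[of "k + t"] Suc.prems by simp
      finally show ?case .
    qed simp
    from this[of "depth - 1"] have "growth ^ (depth - 1) * ?g k \<le> ?g n"
      unfolding n_eq by simp
    moreover have "real N / 8 * ?g k \<le> growth ^ (depth - 1) * ?g k"
      using growth_power by (intro mult_right_mono) auto
    \<comment> \<open>The factor 80 is 10 from \<open>card_lost\<close> times 8 from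
      \<open>growth_power\<close>.\<close>
    moreover have "80 * real m * real depth * ?g k \<le> real N * ?g k"
      using m_le by (intro mult_right_mono) (auto intro: order_trans[rotated])
    ultimately have "10 * real m * ?g k * real depth \<le> ?g n" by (simp add: mult_ac)
    then have "10 * real m * ?g k \<le> ?g n / real depth"
      using depth_pos by (simp add: le_divide_eq)
    moreover have "2 * ?g n - 10 * real m * ?g k \<le> ?g (Suc n)"
    proof -
      have "survivors (Suc n) \<subseteq> children n (survivors n)" by auto
      then have "card (children n (survivors n)) = card (survivors (Suc n))
          + card (children n (survivors n) - survivors (Suc n))"
        using card_Int_Diff[OF finite_children[OF finite_survivors], of n n "survivors (Suc n)"]
        by (simp only: Int_absorb1)
      then show ?thesis using card_lost[OF k] children by linarith
    qed
    ultimately show ?thesis by (simp add: growth_def algebra_simps)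
  qed
qed

lemma survivors_nonempty: "survivors n \<noteq> {}"
proof -
  have "card (survivors n) > 0"
  proof (induction n)
    case (Suc n)
    then have "0 < growth * real (card (survivors n))" using growth_ge_1 by simp
    then show ?case using card_survivors_growth[of n] by linarith
  qed simp
  then show ?thesis by force
qed

theorem exists_avoiding_point:
  "\<exists>x. \<forall>i\<in>{1..m}. \<forall>k. \<forall>p\<in>P i k. x \<notin> {p<..<p + \<rho> ^ k / real N}"
proof -
  define K where "K n = (\<Union>v\<in>survivors n. {v..v + \<rho> ^ n})" for n
  have "\<Inter> (range K) \<noteq> {}"
  proof (rule compact_nest)
    show "compact (K n)" for n
      unfolding K_def using finite_survivors by (intro compact_UN) auto
    show "K n \<noteq> {}" for n
      using survivors_nonempty[of n] \<rho>_pos unfolding K_def by force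
    fix n n' :: nat assume "n \<le> n'"
    then obtain t where "n' = n + t" using le_Suc_ex by blast
    then show "K n' \<subseteq> K n" unfolding K_def using survivor_ancestor by (smt (verit) UN_iff subset_iff)
  qed
  then obtain x where x: "x \<in> K n" for n by blast
  have "x \<notin> {p<..<p + \<rho> ^ k / real N}" if "i \<in> {1..m}" "p \<in> P i k" for i k p
  proof -
    \<comment> \<open>A level-\<open>k\<close> gap is excluded by the test at level
      \<open>k + depth\<close>, which is a successor because \<open>depth\<close> is
      positive.\<close>
    obtain v where v: "v \<in> survivors (k + depth)" "x \<in> {v..v + \<rho> ^ (k + depth)}"
      using x[of "k + depth"] unfolding K_def by blast
    obtain n where n: "k + depth = Suc n" using depth_pos by (cases "k + depth") auto
    have "\<not> meets_gap (k + depth) v" using v(1) unfolding n by simp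
    then have "{v..v + \<rho> ^ (k + depth)} \<inter> {p<..<p + \<rho> ^ k / real N} = {}"
      using that unfolding meets_gap_def by auto
    then show ?thesis using v(2) by blast
  qed
  then show ?thesis by blast
qed

end

section \<open>Periodic gaps and the passage to the circle\<close>

text \<open>Across different periods the shift is at least 1, while left endpoints within a period
  differ by at most \<open>1 - \<rho> ^ k\<close>.\<close>

lemma (in middle_cantor) separated_lefts_periodic:
  "separated (\<rho> ^ k) {l + of_int z + c |l z. l \<in> lefts k}"
  unfolding separated_def
proof (intro ballI impI)
  fix x y assume "x \<in> {l + of_int z + c |l z. l \<in> lefts k}" "y \<in> {l + of_int z + c |l z. l \<in> lefts k}"
    and "x \<noteq> y"
  then obtain l z l' z' where *: "l \<in> lefts k" "l' \<in> lefts k"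
    "x = l + of_int z + c" "y = l' + of_int z' + c" by blast
  show "\<rho> ^ k \<le> \<bar>x - y\<bar>"
  proof (cases "z = z'")
    case True
    then show ?thesis
      using * \<open>x \<noteq> y\<close> separated_lefts_weak[of k] unfolding separated_def by auto
  next
    case False
    then have "real_of_int \<bar>z - z'\<bar> \<ge> 1" by linarith
    moreover have "\<bar>l - l'\<bar> \<le> 1 - \<rho> ^ k" using subsetD[OF lefts_bounds *(1)] subsetD[OF lefts_bounds *(2)] by auto
    ultimately show ?thesis using *(3,4) by simp
  qed
qed

theorem mainTheorem1:
  fixes N m :: nat and a :: "nat \<Rightarrow> real"
  assumes "N \<ge> 2"
    and "m = nat \<lfloor>real N / (100 * log 2 (real N))\<rfloor>"
  shows "(\<Inter>i\<in>{1..m}. translate_mod1 (middle_cantor_set N) (a i)) \<noteq> {}"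
proof -
  interpret middle_cantor N using assms(1) by unfold_locales
  \<comment> \<open>The gap of an interval starts where its left child ends, hence the offset
    \<open>\<rho> ^ Suc k\<close>; \<open>z\<close> ranges over all periods, so avoidance on the
    line gives avoidance modulo 1.\<close>
  define P where "P i k = {l + of_int z + (a i + \<rho> ^ Suc k) |l z. l \<in> lefts k}" for i k
  have "100 * real m * real depth \<le> real N"
  proof -
    have log: "log 2 (real N) \<ge> 1" using depth_pos depth_le_log by linarith
    then have "real m \<le> real N / (100 * log 2 (real N))" unfolding assms(2) by (simp add: of_nat_floor)
    then have "100 * real m * log 2 (real N) \<le> real N" using log by (simp add: field_simps)
    moreover have "100 * real m * real depth \<le> 100 * real m * log 2 (real N)"
      using depth_le_log by (intro mult_left_mono) auto
    ultimately show ?thesis by linarith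
  qed
  then interpret avoidance N m P
    using separated_lefts_periodic unfolding P_def by unfold_locales auto
  obtain x where x: "\<And>i k p. i \<in> {1..m} \<Longrightarrow> p \<in> P i k \<Longrightarrow> x \<notin> {p<..<p + \<rho> ^ k / real N}"
    using exists_avoiding_point by blast
  have "abs_circle x \<in> translate_mod1 (middle_cantor_set N) (a i)" if i: "i \<in> {1..m}" for i
  proof -
    have "frac (x - a i) \<in> middle_cantor_set N"
    proof (rule middle_cantor_setI)
      show "frac (x - a i) \<in> {0..1}" using frac_lt_1[of "x - a i"] by simp
      fix k l assume "l \<in> lefts k"
      \<comment> \<open>The period is chosen so that subtracting it and \<open>a i\<close> from
        \<open>x\<close> leaves the fractional part.\<close>
      then have "l + of_int \<lfloor>x - a i\<rfloor> + (a i + \<rho> ^ Suc k) \<in> P i k" unfolding P_def by blast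
      from x[OF i this]
      show "frac (x - a i) \<notin> {l + \<rho> ^ Suc k<..<l + \<rho> ^ Suc k + \<rho> ^ k / real N}"
        by (auto simp: frac_def simp del: power_Suc)
    qed
    moreover have "abs_circle (frac (x - a i) + a i) = abs_circle x"
      by (simp add: circle.abs_eq_iff frac_def)
    ultimately show ?thesis unfolding translate_mod1_def by (metis imageI)
  qed
  then show ?thesis by blast
qed

end
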